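(* Let $P\in\mathbb{R}^{n\times n}$ be an irreducible and aperiodic Markov transition matrix with strictly positive stationary distribution $\pi$, and let $U_{\perp 1}=I_n-\mathbf{1}\pi^{\top}$ and $V_{\perp 1}=\{f\in\ell^2(\pi):\langle f,\mathbf{1}\rangle_\pi=0\}$. Then for every integer $k\ge 1$, $$\|P^{k}U_{\perp 1}\|_{\ell^2(\pi)}=\sup_{\substack{f\in V_{\perp 1}\\ \|f\|_{\ell^2(\pi)}=1}}\|P^kf\|_{\ell^2(\pi)}=\|p^k-\pi\|_{\ell^2(\pi)}=\sigma_2(P^k).$$
   Context: $P=(p(i,j))_{i,j\in[n]}$ is a row-stochastic $n\times n$ matrix ($n\ge 2$), $\pi\in\mathbb{R}^n$ is a column vector with $\pi^\top P=\pi^\top$, $\sum_i\pi_i=1$ and $\pi_i>0$ for all $i\in[n]=\{1,\dots,n\}$; $\mathbf{1}$ is the all-ones column vector. $\ell^2(\pi)$ is $\mathbb{R}^n$ with inner product $\langle f,g\rangle_\pi=\sum_i f_ig_i\pi_i$ and norm $\|f\|_{\ell^2(\pi)}=\langle f,f\rangle_\pi^{1/2}$; for a matrix $A$, $\|A\|_{\ell^2(\pi)}$ is the induced operator norm. $\pi(f)=\sum_i\pi_if_i$, also identified with the constant function $\pi(f)\mathbf{1}$. The $\ell^2(\pi)$-distance to stationarity after $k$ steps is $$\|p^k-\pi\|_{\ell^2(\pi)}:=\sup_{f\in\ell^2(\pi):\,\|f-\pi(f)\|_{\ell^2(\pi)}=1}\|P^kf-\pi(f)\|_{\ell^2(\pi)}.$$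 $P^*$ denotes the adjoint of $P$ on $\ell^2(\pi)$. The singular values of $P^k$ on $\ell^2(\pi)$ are $\sigma_i(P^k)=\sqrt{\lambda_i(P^k(P^* )^k)}$, where $\lambda_1\ge\dots\ge\lambda_n$ are the eigenvalues of $P^k(P^* )^k$ counted with multiplicity. *)

theory Defs
  imports "HOL-Analysis.Analysis" "HOL-Computational_Algebra.Polynomial"
begin

(* The index set [n] is a finite type 'n. The library instances of times and power on
   real^'n^'n act componentwise, so matrix powers are iterates of (**). *)

primrec mat_pow :: "real^'n^'n \<Rightarrow> nat \<Rightarrow> real^'n^'n" where
  "mat_pow A 0 = mat 1"
| "mat_pow A (Suc k) = A ** mat_pow A k"

definition row_stochastic :: "real^'n^'n \<Rightarrow> bool" where
  "row_stochastic P \<longleftrightarrow> (\<forall>i j. 0 \<le> P $ i $ j) \<and> (\<forall>i. (\<Sum>j\<in>UNIV. P $ i $ j) = 1)"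

definition irreducible_chain :: "real^'n^'n \<Rightarrow> bool" where
  "irreducible_chain P \<longleftrightarrow> (\<forall>i j. \<exists>k\<ge>1. 0 < mat_pow P k $ i $ j)"

definition aperiodic_chain :: "real^'n^'n \<Rightarrow> bool" where
  "aperiodic_chain P \<longleftrightarrow> (\<forall>i. Gcd {k::nat. 1 \<le> k \<and> 0 < mat_pow P k $ i $ i} = 1)"

definition positive_stationary :: "real^'n \<Rightarrow> real^'n^'n \<Rightarrow> bool" where
  "positive_stationary w P \<longleftrightarrow>
     w v* P = w \<and> (\<Sum>i\<in>UNIV. w $ i) = 1 \<and> (\<forall>i. 0 < w $ i)"

definition inner_l2 :: "real^'n \<Rightarrow> real^'n \<Rightarrow> real^'n \<Rightarrow> real" where
  "inner_l2 w f g = (\<Sum>i\<in>UNIV. f $ i * g $ i * w $ i)"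

definition norm_l2 :: "real^'n \<Rightarrow> real^'n \<Rightarrow> real" where
  "norm_l2 w f = sqrt (inner_l2 w f f)"

definition opnorm_l2 :: "real^'n \<Rightarrow> real^'n^'n \<Rightarrow> real" where
  "opnorm_l2 w A = (SUP f\<in>{f. norm_l2 w f = 1}. norm_l2 w (A *v f))"

(* The function w(f), as a constant function on [n]. *)
definition mean_fun :: "real^'n \<Rightarrow> real^'n \<Rightarrow> real^'n" where
  "mean_fun w f = (\<chi> i. \<Sum>j\<in>UNIV. w $ j * f $ j)"

definition dist_stationary_l2 :: "real^'n \<Rightarrow> real^'n^'n \<Rightarrow> nat \<Rightarrow> real" where
  "dist_stationary_l2 w P k =
     (SUP f\<in>{f. norm_l2 w (f - mean_fun w f) = 1}. norm_l2 w (mat_pow P k *v f - mean_fun w f))"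

definition adjoint_l2 :: "real^'n \<Rightarrow> real^'n^'n \<Rightarrow> real^'n^'n" where
  "adjoint_l2 w A = (THE B. \<forall>f g. inner_l2 w (A *v f) g = inner_l2 w f (B *v g))"

lemma adjoint_l2_unique:
  fixes w :: "real^'n" and A :: "real^'n^'n"
  assumes pos: "\<And>i. 0 < w $ i"
  shows "(\<forall>f g. inner_l2 w (A *v f) g = inner_l2 w f (B *v g)) \<longleftrightarrow>
         B = (\<chi> i j. w $ j * A $ j $ i / w $ i)"
proof
  assume adj: "\<forall>f g. inner_l2 w (A *v f) g = inner_l2 w f (B *v g)"
  have "B $ i $ j = w $ j * A $ j $ i / w $ i" for i j
  proof -
    have *: "(C *v axis i 1) $ j = C $ j $ i" for C :: "real^'n^'n" and i j
      by (simp add: matrix_vector_mult_basis column_def)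
    have "inner_l2 w f (axis j 1) = f $ j * w $ j" "inner_l2 w (axis j 1) f = f $ j * w $ j" for f j
      by (simp_all add: inner_l2_def axis_def if_distrib if_distribR cong: if_cong)
    then have "inner_l2 w (A *v axis i 1) (axis j 1) = A $ j $ i * w $ j"
      and "inner_l2 w (axis i 1) (B *v axis j 1) = B $ i $ j * w $ i"
      by (simp_all only: *)
    moreover have "inner_l2 w (A *v axis i 1) (axis j 1) = inner_l2 w (axis i 1) (B *v axis j 1)"
      using adj by blast
    ultimately have "A $ j $ i * w $ j = B $ i $ j * w $ i" by simp
    then show ?thesis using pos[of i] by (simp add: field_simps)
  qed
  then show "B = (\<chi> i j. w $ j * A $ j $ i / w $ i)" by (simp add: vec_eq_iff)
next
  assume B: "B = (\<chi> i j. w $ j * A $ j $ i / w $ i)"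
  have "w $ i \<noteq> 0" for i using pos[of i] by simp
  then have "inner_l2 w f (B *v g) = (\<Sum>i\<in>UNIV. \<Sum>j\<in>UNIV. f $ i * g $ j * w $ j * A $ j $ i)" for f g
    by (simp add: B inner_l2_def matrix_vector_mult_def sum_distrib_left sum_distrib_right mult_ac)
  moreover have "inner_l2 w (A *v f) g = (\<Sum>j\<in>UNIV. \<Sum>i\<in>UNIV. f $ i * g $ j * w $ j * A $ j $ i)" for f g
    by (simp add: inner_l2_def matrix_vector_mult_def sum_distrib_right sum_distrib_left mult_ac)
  ultimately have "inner_l2 w (A *v f) g = inner_l2 w f (B *v g)" for f g
    by (simp only:) (rule sum.swap)
  then show "\<forall>f g. inner_l2 w (A *v f) g = inner_l2 w f (B *v g)" by blast
qed

definition charpoly :: "real^'n^'n \<Rightarrow> real poly" where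
  "charpoly A = det (\<chi> i j. (if i = j then [:0, 1:] else 0) - [:A $ i $ j:])"

(* The real eigenvalues with algebraic multiplicity, in descending order. For a matrix
   self-adjoint on a weighted l2 space, such as P^k (P^* )^k, this lists all n of them. *)
definition eigvals_desc :: "real^'n^'n \<Rightarrow> real list" where
  "eigvals_desc A = rev (sorted_list_of_multiset (proots (charpoly A)))"

(* i is 1-based, as in sigma_1 \<ge> sigma_2 \<ge> ... *)
definition sigma_pow :: "real^'n \<Rightarrow> nat \<Rightarrow> real^'n^'n \<Rightarrow> nat \<Rightarrow> real" where
  "sigma_pow w i P k =
     sqrt (eigvals_desc (mat_pow P k ** mat_pow (adjoint_l2 w P) k) ! (i - 1))"

definition U_perp1 :: "real^'n \<Rightarrow> real^'n^'n" where
  "U_perp1 w = mat 1 - columnvector (1 :: real^'n) ** (rowvector w :: real^'n^1)"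

definition V_perp1 :: "real^'n \<Rightarrow> (real^'n) set" where
  "V_perp1 w = {f. inner_l2 w f 1 = 0}"

end

theory Submission
  imports Defs
begin

text \<open>Write \<open>A = P\<^sup>k\<close>, let \<open>B\<close> be its adjoint, and let \<open>s\<close> be the maximum of \<open>\<parallel>A f\<parallel>\<close> over the
  unit sphere of \<open>V\<close>, the orthogonal complement of the constants. Since \<open>A\<close> fixes the constants and
  preserves \<open>V\<close>, both the operator norm and the distance to stationarity equal \<open>s\<close>. A maximizer
  \<open>f\<close> satisfies \<open>B A f = s\<^sup>2 f\<close>, so \<open>A f\<close> is an eigenvector of \<open>A B\<close> in \<open>V\<close>, and \<open>s\<^sup>2\<close> is the
  largest eigenvalue of \<open>A B\<close> on \<open>V\<close>. Algebraic multiplicities are handled without the spectral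
  theorem: the deflated matrix \<open>D = A B - 1 \<pi>\<^sup>T\<close> satisfies
  \<open>X \<chi>(A B) = (X - 1) \<chi>(D)\<close> for the characteristic polynomials, so the spectrum of \<open>A B\<close> is
  that of \<open>D\<close> with one 0 replaced by 1. Jensen's inequality gives \<open>s \<le> 1\<close>, so \<open>s\<^sup>2\<close> comes second
  in descending order.\<close>

subsection \<open>A rank-one update of the identity\<close>

text \<open>Cramer's lemma for the identity matrix, whose rows \<open>axis i 1\<close> combine to
  \<open>x\<close> with the entries of \<open>x\<close> as coefficients.\<close>

lemma det_identity_replace_row:
  fixes x :: "'a::field^'n"
  shows "det (\<chi> i. if i = a then x else axis i 1) = x $ a"
proof -
  have *: "row i (mat 1 :: 'a^'n^'n) = axis i 1" for i
    by (simp add: row_def mat_def axis_def vec_eq_iff)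
  show ?thesis
    using cramer_lemma_transpose[of a x "mat 1"] by (simp only: * basis_expansion det_I mult_1_right)
qed

text \<open>Induction on the set of rows changed so far. Row \<open>a\<close> splits additively: the
  part \<open>axis a 1\<close> gives the induction hypothesis. In the part \<open>u $ a *s v\<close>
  the multiples of \<open>v\<close> in the other rows can be cleared, which leaves
  \<open>u $ a * v $ a\<close>.\<close>

lemma det_rank_one_rows:
  fixes u v :: "'a::field^'n"
  assumes "finite S"
  shows "det (\<chi> i. axis i 1 + (if i \<in> S then u $ i *s v else 0)) = 1 + (\<Sum>i\<in>S. u $ i * v $ i)"
  using assms
proof (induction S)
  case empty
  have "(\<chi> i. axis i 1 + (if i \<in> {} then u $ i *s v else 0)) = (mat 1 :: 'a^'n^'n)"
    by (simp add: vec_eq_iff mat_def axis_def)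
  then show ?case by (simp only: det_I sum.empty) simp
next
  case (insert a S)
  define r where "r i = axis i 1 + (if i \<in> S then u $ i *s v else 0)" for i
  \<comment> \<open>Left multiplication by \<open>B\<close> adds \<open>u $ i\<close> times row
    \<open>a\<close> to each row \<open>i\<close> in \<open>S\<close>. This is a row operation of
    determinant 1, and it restores the multiples of \<open>v\<close>.\<close>
  define B :: "'a^'n^'n" where "B = (\<chi> i. axis i 1 + (if i \<in> S then u $ i else 0) *s axis a 1)"
  define C :: "'a^'n^'n" where "C = (\<chi> i. if i = a then v else axis i 1)"
  have "B ** C = (\<chi> i. if i = a then v else r i)"
  proof -
    have "(B ** C) $ i $ j = C $ i $ j + (if i \<in> S then u $ i else 0) * C $ a $ j" for i j
      by (simp add: B_def matrix_matrix_mult_def axis_def distrib_right sum.distrib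
          if_distribR cong: if_cong) (simp add: if_distrib if_distribR cong: if_cong)
    then show ?thesis
      using insert.hyps by (auto simp: vec_eq_iff C_def r_def axis_def)
  qed
  moreover have "det B = 1"
  proof -
    have "transpose B = (\<chi> i. if i = a then (\<chi> j. if j = a then 1 else if j \<in> S then u $ j else 0) else axis i 1)"
      using insert.hyps by (auto simp: vec_eq_iff transpose_def B_def axis_def)
    then show ?thesis
      using det_transpose[of B] by (simp add: det_identity_replace_row)
  qed
  moreover have "det C = v $ a"
    by (simp add: C_def det_identity_replace_row)
  ultimately have v: "det (\<chi> i. if i = a then v else r i) = v $ a"
    by (metis det_mul mult_1)
  have "(\<chi> i. axis i 1 + (if i \<in> insert a S then u $ i *s v else 0))
      = (\<chi> i. if i = a then axis i 1 + u $ i *s v else r i)"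
    using insert.hyps by (auto simp: vec_eq_iff r_def)
  moreover have "(\<chi> i. if i = a then axis i 1 else r i) = (\<chi> i. r i)"
    using insert.hyps by (auto simp: vec_eq_iff r_def)
  moreover have "(\<chi> i. if i = a then u $ i *s v else r i) = (\<chi> i. if i = a then u $ a *s v else r i)"
    by (auto simp: vec_eq_iff)
  ultimately show ?case
    using insert by (simp add: det_row_add det_row_mul v flip: r_def)
qed

text \<open>The matrix determinant lemma, obtained by changing all rows.\<close>

lemma det_rank_one_update:
  fixes u v :: "'a::field^'n"
  shows "det (mat 1 + (\<chi> i j. u $ i * v $ j)) = 1 + (\<Sum>i\<in>UNIV. u $ i * v $ i)"
proof -
  have "mat 1 + (\<chi> i j. u $ i * v $ j) = (\<chi> i. axis i 1 + (if i \<in> UNIV then u $ i *s v else 0))"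
    by (simp add: vec_eq_iff mat_def axis_def)
  then show ?thesis
    by (simp only: det_rank_one_rows[OF finite])
qed

subsection \<open>Characteristic polynomials and sorted spectra\<close>

lemma poly_charpoly:
  fixes A :: "real^'n^'n"
  shows "poly (charpoly A) x = det (mat x - A)"
proof -
  have "poly (if i = j then [:0, 1:] else 0) x = mat x $ i $ j" for i j :: 'n
    by (simp add: mat_def)
  then show ?thesis
    by (simp add: charpoly_def det_def poly_sum poly_prod)
qed

lemma poly_charpoly_eq_0_iff:
  fixes A :: "real^'n^'n"
  shows "poly (charpoly A) x = 0 \<longleftrightarrow> (\<exists>f. f \<noteq> 0 \<and> A *v f = x *s f)"
proof -
  have "poly (charpoly A) x = 0 \<longleftrightarrow> (\<exists>f. f \<noteq> 0 \<and> (mat x - A) *v f = 0)"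
    using invertible_det_nz[of "mat x - A"] matrix_left_invertible_ker[of "mat x - A"]
      invertible_left_inverse[of "mat x - A"]
    by (auto simp: poly_charpoly)
  moreover have "(mat x - A) *v f = x *s f - A *v f" for f
  proof -
    have "mat x *v f = x *s f"
      by (simp add: vec_eq_iff matrix_vector_mult_def mat_def if_distrib[of "\<lambda>a. a * b" for b] cong: if_cong)
    then show ?thesis by (simp add: matrix_vector_mult_diff_rdistrib)
  qed
  ultimately show ?thesis by auto
qed

lemma rev_sorted_list_of_multiset_add_max:
  assumes "\<And>x. x \<in># M \<Longrightarrow> x \<le> m"
  shows "rev (sorted_list_of_multiset (add_mset m M)) = m # rev (sorted_list_of_multiset M)"
proof -
  have "sort (sorted_list_of_multiset M @ [m]) = sorted_list_of_multiset M @ [m]"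
    using assms by (intro sorted_sort_id) (simp add: sorted_append)
  moreover have "add_mset m M = mset (sorted_list_of_multiset M @ [m])"
    by simp
  ultimately show ?thesis
    by (metis sorted_list_of_multiset_mset rev.simps(2) rev_rev_ident rev_append append_Cons append_Nil)
qed

text \<open>First \<open>m\<close> and then \<open>t\<close> splits off as a maximum. Lists count
  from 0, so index 1 is the second entry.\<close>

lemma second_of_sorted_multiset:
  assumes "t \<in># M" "\<And>x. x \<in># M \<Longrightarrow> x \<le> t" "t \<le> m"
  shows "rev (sorted_list_of_multiset (add_mset m M)) ! 1 = t"
proof -
  obtain T where "M = add_mset t T"
    using assms(1) by (metis mset_add)
  moreover have "\<And>x. x \<in># M \<Longrightarrow> x \<le> m"
    using assms by force
  ultimately show ?thesis
    using assms(2) rev_sorted_list_of_multiset_add_max[of M m] rev_sorted_list_of_multiset_add_max[of T t]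
    by (simp del: sorted_list_of_multiset_insert)
qed

text \<open>Serves the degenerate case \<open>s = 0\<close>, where the deflated matrix vanishes and
  the multiplicity of 0 matters.\<close>

lemma proots_charpoly_0: "proots (charpoly (0 :: real^'n^'n)) = replicate_mset (CARD('n)) 0"
proof -
  have "poly (charpoly (0 :: real^'n^'n)) x = poly ([:0, 1:] ^ CARD('n)) x" for x
    by (simp add: poly_charpoly det_diagonal mat_def)
  then have "charpoly (0 :: real^'n^'n) = [:-0, 1:] ^ CARD('n)"
    by (simp add: poly_eq_poly_eq_iff[symmetric] fun_eq_iff)
  then show ?thesis
    by (simp only: proots_power proots_linear_factor) simp
qed

lemma matrix_diff_rdistrib:
  fixes A B :: "'a::ring_1^'n^'m"
  shows "(A - B) ** C = A ** C - B ** C"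
  by (simp add: vec_eq_iff matrix_matrix_mult_def left_diff_distrib sum_subtractf)

definition mean_mat :: "real^'n \<Rightarrow> real^'n^'n" where
  "mean_mat w = (\<chi> i j. w $ j)"

lemma mean_mat_mult_vec: "mean_mat w *v f = mean_fun w f"
  by (simp add: mean_mat_def mean_fun_def matrix_vector_mult_def)

lemma mean_fun_eq_inner: "mean_fun w f = inner_l2 w f 1 *s 1"
  by (simp add: mean_fun_def inner_l2_def vec_eq_iff mult.commute)

text \<open>Subtracting the projection onto the constants moves one eigenvalue from 1 to 0 and leaves
  the others, with their algebraic multiplicities, unchanged.\<close>

lemma charpoly_deflate:
  fixes M :: "real^'n^'n"
  assumes w: "(\<Sum>i\<in>UNIV. w $ i) = 1" and M: "M *v 1 = 1"
  shows "[:0, 1:] * charpoly M = [:-1, 1:] * charpoly (M - mean_mat w)"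
proof -
  have MK: "M ** mean_mat w = mean_mat w"
  proof -
    have "(\<Sum>j\<in>UNIV. M $ i $ j) = 1" for i
      using arg_cong[OF M, of "\<lambda>v. v $ i"] by (simp add: matrix_vector_mult_def)
    then show ?thesis
      by (simp add: vec_eq_iff matrix_matrix_mult_def mean_mat_def flip: sum_distrib_right)
  qed
  have "x * poly (charpoly M) x = (x - 1) * poly (charpoly (M - mean_mat w)) x" if "x \<noteq> 1" for x
  proof -
    \<comment> \<open>Since \<open>M\<close> fixes the constants, \<open>mat x - M\<close>
      multiplies \<open>mean_mat w\<close> by \<open>x - 1\<close>. The factor
      \<open>1 / (x - 1)\<close> therefore adds exactly one copy of \<open>mean_mat w\<close> to
      \<open>mat x - M\<close>.\<close>
    define R :: "real^'n^'n" where "R = mat 1 + (\<chi> i j. (1 / (x - 1)) * w $ j)"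
    have "det R = 1 + (\<Sum>i\<in>UNIV. 1 / (x - 1) * w $ i)"
      using det_rank_one_update[of "\<chi> i. 1 / (x - 1)" w] by (simp add: R_def)
    also have "\<dots> = x / (x - 1)"
      using that by (simp add: w field_simps flip: sum_divide_distrib)
    finally have "det R = x / (x - 1)" .
    moreover have "(mat x - M) ** R = mat x - (M - mean_mat w)"
    proof -
      have R: "R = mat 1 + (1 / (x - 1)) *\<^sub>R mean_mat w"
        by (simp add: R_def mean_mat_def vec_eq_iff)
      have "mat x ** mean_mat w = x *\<^sub>R mean_mat w"
        by (simp add: vec_eq_iff matrix_matrix_mult_def mat_def if_distrib[of "\<lambda>a. a * b" for b] cong: if_cong)
      then have "(mat x - M) ** mean_mat w = (x - 1) *\<^sub>R mean_mat w"
        by (simp add: matrix_diff_rdistrib MK scaleR_left_diff_distrib)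
      then show ?thesis
        using that by (simp add: R matrix_add_ldistrib matrix_scalar_ac flip: scalar_matrix_assoc)
    qed
    ultimately have "det (mat x - M) * (x / (x - 1)) = det (mat x - (M - mean_mat w))"
      by (metis det_mul)
    then show ?thesis
      using that by (simp add: poly_charpoly field_simps)
  qed
  \<comment> \<open>The extra factor \<open>[:-1, 1:]\<close> vanishes at the excluded point 1, so
    both sides agree everywhere. It is cancelled afterwards.\<close>
  then have "poly ([:-1, 1:] * ([:0, 1:] * charpoly M)) x
      = poly ([:-1, 1:] * ([:-1, 1:] * charpoly (M - mean_mat w))) x" for x
    by (cases "x = 1") (simp_all only: poly_mult, simp_all)
  then have "[:-1, 1:] * ([:0, 1:] * charpoly M)
      = [:-1, 1:] * ([:-1, 1:] * charpoly (M - mean_mat w))"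
    unfolding poly_eq_poly_eq_iff[symmetric] fun_eq_iff by blast
  then show ?thesis
    by (simp only: mult_cancel_left pCons_eq_0_iff) simp
qed


subsection \<open>The weighted inner product\<close>

lemma inner_l2_commute: "inner_l2 w f g = inner_l2 w g f"
  by (simp add: inner_l2_def mult_ac)

lemma inner_l2_add_left: "inner_l2 w (f + g) h = inner_l2 w f h + inner_l2 w g h"
  by (simp add: inner_l2_def distrib_right sum.distrib)

lemma inner_l2_add_right: "inner_l2 w h (f + g) = inner_l2 w h f + inner_l2 w h g"
  by (simp add: inner_l2_commute[of w h] inner_l2_add_left)

lemma inner_l2_diff_left: "inner_l2 w (f - g) h = inner_l2 w f h - inner_l2 w g h"
  by (simp add: inner_l2_def left_diff_distrib sum_subtractf)

lemma inner_l2_diff_right: "inner_l2 w h (f - g) = inner_l2 w h f - inner_l2 w h g"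
  by (simp add: inner_l2_commute[of w h] inner_l2_diff_left)

lemma inner_l2_scale_left: "inner_l2 w (c *s f) h = c * inner_l2 w f h"
  by (simp add: inner_l2_def sum_distrib_left mult_ac)

lemma inner_l2_scale_right: "inner_l2 w h (c *s f) = c * inner_l2 w h f"
  by (simp add: inner_l2_commute[of w h] inner_l2_scale_left)

lemmas inner_l2_bilinear =
  inner_l2_add_left inner_l2_add_right inner_l2_diff_left inner_l2_diff_right
  inner_l2_scale_left inner_l2_scale_right

locale positive_weight =
  fixes w :: "real^'n"
  assumes w_pos: "0 < w $ i"
begin

lemma inner_l2_self_nonneg: "0 \<le> inner_l2 w f f"
  by (auto simp: inner_l2_def less_imp_le[OF w_pos] intro!: sum_nonneg)

lemma inner_l2_self_eq_0: "inner_l2 w f f = 0 \<longleftrightarrow> f = 0"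
proof
  assume "inner_l2 w f f = 0"
  then have "\<forall>i\<in>UNIV. f $ i * f $ i * w $ i = 0"
    unfolding inner_l2_def
    by (subst (asm) sum_nonneg_eq_0_iff) (auto simp: less_imp_le[OF w_pos])
  then show "f = 0"
    using w_pos by (auto simp: vec_eq_iff) (metis less_irrefl)
qed (simp add: inner_l2_def)

lemma norm_l2_nonneg: "0 \<le> norm_l2 w f"
  by (simp add: norm_l2_def inner_l2_self_nonneg)

lemma norm_l2_squared: "(norm_l2 w f)\<^sup>2 = inner_l2 w f f"
  by (simp add: norm_l2_def inner_l2_self_nonneg)

lemma norm_l2_eq_0: "norm_l2 w f = 0 \<longleftrightarrow> f = 0"
  by (simp add: norm_l2_def inner_l2_self_eq_0)

lemma norm_l2_scale: "norm_l2 w (c *s f) = \<bar>c\<bar> * norm_l2 w f"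
  by (simp add: norm_l2_def inner_l2_scale_left inner_l2_scale_right real_sqrt_mult flip: mult.assoc)

lemma eq_if_inner_l2_eq:
  assumes "\<And>h. inner_l2 w h f = inner_l2 w h g"
  shows "f = g"
proof -
  have "inner_l2 w (f - g) (f - g) = 0"
    using assms by (simp add: inner_l2_diff_right)
  then show ?thesis by (simp add: inner_l2_self_eq_0)
qed

lemma continuous_on_norm_l2: "continuous_on S (\<lambda>f. norm_l2 w (A *v f))"
  unfolding norm_l2_def inner_l2_def matrix_vector_mult_def
  by (simp, intro continuous_intros)

text \<open>Continuous equations give closedness; positive weights bound each coordinate by
  \<open>sqrt (1 / w $ i)\<close>.\<close>

lemma compact_V_perp_sphere: "compact {f \<in> V_perp1 w. norm_l2 w f = 1}"
proof -
  have "closed {f. inner_l2 w f 1 = 0 \<and> norm_l2 w f = 1}"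
    unfolding norm_l2_def inner_l2_def
    by (intro closed_Collect_conj closed_Collect_eq continuous_intros)
  moreover have "norm f \<le> (\<Sum>i\<in>UNIV. sqrt (1 / w $ i))" if "norm_l2 w f = 1" for f
  proof -
    have "\<bar>f $ i\<bar> \<le> sqrt (1 / w $ i)" for i
    proof -
      have "f $ i * f $ i * w $ i \<le> inner_l2 w f f"
        unfolding inner_l2_def
        by (rule member_le_sum) (auto simp: less_imp_le[OF w_pos])
      then have "(f $ i)\<^sup>2 \<le> 1 / w $ i"
        using that w_pos[of i] by (simp add: norm_l2_def field_simps power2_eq_square)
      then show ?thesis
        using real_sqrt_le_mono by fastforce
    qed
    then show ?thesis
      by (intro order_trans[OF norm_le_l1_cart] sum_mono)
  qed
  ultimately show ?thesis
    by (auto simp: compact_eq_bounded_closed V_perp1_def bounded_iff intro!: exI)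
qed

lemma V_perp_sphere_nonempty:
  assumes "CARD('n) \<ge> 2"
  shows "{f \<in> V_perp1 w. norm_l2 w f = 1} \<noteq> {}"
proof -
  obtain i j :: 'n where "i \<noteq> j"
    using assms by (metis UNIV_I card_2_iff' card_le_Suc0_iff_eq finite not_less_eq_eq numeral_2_eq_2)
  \<comment> \<open>The two values are chosen so that their weighted contributions
    \<open>w $ j * w $ i\<close> cancel in the mean.\<close>
  define f where "f = axis i (w $ j) - axis j (w $ i)"
  have "inner_l2 w f 1 = 0"
    by (simp add: f_def inner_l2_def axis_def left_diff_distrib sum_subtractf
        if_distrib[of "\<lambda>a. a * b" for b] cong: if_cong)
  moreover have "f $ i \<noteq> 0"
    using w_pos[of j] \<open>i \<noteq> j\<close> by (simp add: f_def axis_def)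
  then have "norm_l2 w f > 0"
    using norm_l2_nonneg[of f] norm_l2_eq_0[of f] by force
  ultimately have "(1 / norm_l2 w f) *s f \<in> {f \<in> V_perp1 w. norm_l2 w f = 1}"
    by (simp add: V_perp1_def inner_l2_scale_left norm_l2_scale)
  then show ?thesis by blast
qed

end

text \<open>\<open>A\<close> stands for a power of the chain and \<open>B\<close> for its adjoint.
  The properties assumed of \<open>A\<close> are ones that pass from a matrix to its powers.\<close>

locale markov_l2 = positive_weight w for w :: "real^'n" +
  fixes A B :: "real^'n^'n"
  assumes w_sum: "(\<Sum>i\<in>UNIV. w $ i) = 1"
    and A_nonneg: "0 \<le> A $ i $ j"
    and A_one: "A *v 1 = 1"
    and w_A: "w v* A = w"
    and adjoint: "inner_l2 w (A *v f) g = inner_l2 w f (B *v g)"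
    and card: "CARD('n) \<ge> 2"
begin

section \<open>Largest stretch on the complement of the constants\<close>

definition s where "s = (SUP f\<in>{f \<in> V_perp1 w. norm_l2 w f = 1}. norm_l2 w (A *v f))"

lemma inner_one_one: "inner_l2 w 1 1 = 1"
  by (simp add: inner_l2_def w_sum)

text \<open>Stationarity in dual form: \<open>A\<close> preserves means, hence maps the complement
  of the constants into itself.\<close>

lemma inner_A_one: "inner_l2 w (A *v f) 1 = inner_l2 w f 1"
proof -
  have "inner_l2 w (A *v f) 1 = (\<Sum>j\<in>UNIV. f $ j * (\<Sum>i\<in>UNIV. w $ i * A $ i $ j))"
    unfolding inner_l2_def matrix_vector_mult_def
    by (simp add: sum_distrib_left sum_distrib_right mult_ac) (rule sum.swap)
  also have "\<dots> = inner_l2 w f 1"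
    using arg_cong[OF w_A, of "\<lambda>v. v $ j" for j]
    by (simp add: inner_l2_def vector_matrix_mult_def mult.commute)
  finally show ?thesis .
qed

text \<open>Duality: because \<open>A\<close> preserves means, its adjoint fixes the
  constants.\<close>

lemma B_one: "B *v 1 = 1"
  by (rule eq_if_inner_l2_eq) (metis adjoint inner_A_one)

lemma inner_B_one: "inner_l2 w (B *v f) 1 = inner_l2 w f 1"
  by (metis adjoint A_one inner_l2_commute)

text \<open>Jensen's inequality in each row, then averaging against \<open>w\<close>, which
  stationarity leaves unchanged.\<close>

lemma contraction: "norm_l2 w (A *v f) \<le> norm_l2 w f"
proof -
  have jensen: "((A *v f) $ i)\<^sup>2 \<le> (A *v (\<chi> j. (f $ j)\<^sup>2)) $ i" for i
  proof -
    define m where "m = (A *v f) $ i"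
    have row: "(\<Sum>j\<in>UNIV. A $ i $ j) = 1"
      using arg_cong[OF A_one, of "\<lambda>v. v $ i"] by (simp add: matrix_vector_mult_def)
    \<comment> \<open>The variance of \<open>f\<close> under the probability vector in row
      \<open>i\<close>.\<close>
    have "0 \<le> (\<Sum>j\<in>UNIV. A $ i $ j * (f $ j - m)\<^sup>2)"
      by (intro sum_nonneg) (simp add: A_nonneg)
    also have "\<dots> = (\<Sum>j\<in>UNIV. A $ i $ j * (f $ j)\<^sup>2 - 2 * m * (A $ i $ j * f $ j) + m\<^sup>2 * A $ i $ j)"
      by (intro sum.cong) (simp_all add: power2_eq_square algebra_simps)
    also have "\<dots> = (\<Sum>j\<in>UNIV. A $ i $ j * (f $ j)\<^sup>2) - 2 * m * m + m\<^sup>2"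
      by (simp add: sum.distrib sum_subtractf row m_def matrix_vector_mult_def flip: sum_distrib_left)
    finally show ?thesis
      by (simp add: m_def[symmetric] power2_eq_square) (simp add: matrix_vector_mult_def power2_eq_square)
  qed
  have "inner_l2 w (A *v f) (A *v f) = (\<Sum>i\<in>UNIV. ((A *v f) $ i)\<^sup>2 * w $ i)"
    by (simp add: inner_l2_def power2_eq_square)
  also have "\<dots> \<le> (\<Sum>i\<in>UNIV. (A *v (\<chi> j. (f $ j)\<^sup>2)) $ i * w $ i)"
    by (intro sum_mono mult_right_mono jensen less_imp_le[OF w_pos])
  also have "\<dots> = inner_l2 w (\<chi> j. (f $ j)\<^sup>2) 1"
    by (subst inner_A_one[symmetric]) (simp add: inner_l2_def)
  also have "\<dots> = inner_l2 w f f"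
    by (simp add: inner_l2_def power2_eq_square)
  finally show ?thesis
    by (simp add: norm_l2_def)
qed

lemma maximizer:
  obtains f where "f \<in> V_perp1 w" "norm_l2 w f = 1" "norm_l2 w (A *v f) = s"
    "\<And>g. g \<in> V_perp1 w \<Longrightarrow> norm_l2 w g = 1 \<Longrightarrow> norm_l2 w (A *v g) \<le> s"
proof -
  obtain f where f: "f \<in> {f \<in> V_perp1 w. norm_l2 w f = 1}"
    and max: "\<And>g. g \<in> {f \<in> V_perp1 w. norm_l2 w f = 1} \<Longrightarrow> norm_l2 w (A *v g) \<le> norm_l2 w (A *v f)"
    using continuous_attains_sup[OF compact_V_perp_sphere V_perp_sphere_nonempty[OF card] continuous_on_norm_l2]
    by blast
  then have "s = norm_l2 w (A *v f)"
    unfolding s_def by (intro cSup_eq_maximum) auto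
  with f max show ?thesis
    by (intro that[of f]) auto
qed

lemma s_nonneg: "0 \<le> s"
  by (metis maximizer norm_l2_nonneg)

lemma s_le_1: "s \<le> 1"
  by (metis maximizer contraction)

lemma norm_A_le_sphere: "f \<in> V_perp1 w \<Longrightarrow> norm_l2 w f = 1 \<Longrightarrow> norm_l2 w (A *v f) \<le> s"
  by (metis maximizer)

lemma norm_A_le:
  assumes "f \<in> V_perp1 w"
  shows "norm_l2 w (A *v f) \<le> s * norm_l2 w f"
proof (cases "f = 0")
  case True
  then show ?thesis using s_nonneg norm_l2_eq_0[of 0] by simp
next
  case False
  define c where "c = norm_l2 w f"
  have c: "c > 0"
    using False norm_l2_nonneg[of f] norm_l2_eq_0[of f] by (simp add: c_def less_le)
  then have "norm_l2 w (A *v ((1 / c) *s f)) \<le> s"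
    using assms
    by (intro norm_A_le_sphere) (simp_all add: V_perp1_def inner_l2_scale_left norm_l2_scale c_def)
  then show ?thesis
    using c by (simp add: vector_scalar_commute norm_l2_scale field_simps flip: c_def)
qed

lemma inner_A_le:
  assumes "f \<in> V_perp1 w"
  shows "inner_l2 w (A *v f) (A *v f) \<le> s\<^sup>2 * inner_l2 w f f"
  using power_mono[OF norm_A_le[OF assms] norm_l2_nonneg, of 2]
  by (simp add: norm_l2_squared power_mult_distrib)


text \<open>The quadratic form \<open>s\<^sup>2 \<langle>h, h\<rangle> - \<langle>A h, A h\<rangle>\<close> is nonnegative on the orthogonal
  complement of the constants, so a zero of it lies in its kernel.\<close>

lemma maximizer_eigenvector:
  assumes f: "f \<in> V_perp1 w" "norm_l2 w f = 1" "norm_l2 w (A *v f) = s"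
  shows "B *v (A *v f) = s\<^sup>2 *s f"
proof -
  \<comment> \<open>\<open>h\<close> is the defect in the eigenvalue equation, and the aim is
    \<open>h = 0\<close>. Its squared norm \<open>b\<close> is also half the linear coefficient of
    the form along \<open>f + t *s h\<close>.\<close>
  define h where "h = s\<^sup>2 *s f - B *v (A *v f)"
  define b where "b = inner_l2 w h h"
  define q where "q = s\<^sup>2 * inner_l2 w h h - inner_l2 w (A *v h) (A *v h)"
  have ff: "inner_l2 w f f = 1" "inner_l2 w (A *v f) (A *v f) = s\<^sup>2"
    using f by (simp_all flip: norm_l2_squared)
  have h: "h \<in> V_perp1 w"
    using f(1) by (simp add: h_def V_perp1_def inner_l2_bilinear inner_B_one inner_A_one)
  have "inner_l2 w (B *v (A *v f)) h = inner_l2 w (A *v f) (A *v h)"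
    by (metis adjoint inner_l2_commute)
  moreover have "inner_l2 w (s\<^sup>2 *s f - B *v (A *v f)) h = s\<^sup>2 * inner_l2 w f h - inner_l2 w (B *v (A *v f)) h"
    by (simp only: inner_l2_diff_left inner_l2_scale_left)
  ultimately have b: "s\<^sup>2 * inner_l2 w f h - inner_l2 w (A *v f) (A *v h) = b"
    by (simp only: b_def flip: h_def)
  have quadratic: "0 \<le> 2 * t * b + t\<^sup>2 * q" for t
  proof -
    have "f + t *s h \<in> V_perp1 w"
      using f(1) h by (simp add: V_perp1_def inner_l2_bilinear)
    from inner_A_le[OF this] show ?thesis
      unfolding b[symmetric] q_def
      using ff inner_l2_commute[of w h f] inner_l2_commute[of w "A *v h" "A *v f"]
      by (simp add: matrix_vector_right_distrib vector_scalar_commute inner_l2_bilinear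
          power2_eq_square algebra_simps)
  qed
  \<comment> \<open>With \<open>q < 2 * a\<close>, the choice \<open>t = - b / a\<close> makes the
    quadratic negative unless \<open>b = 0\<close>.\<close>
  define a where "a = \<bar>q\<bar> + 1"
  have a: "0 < a" "q < 2 * a"
    by (auto simp: a_def)
  have "b\<^sup>2 * (q - 2 * a) = a\<^sup>2 * (2 * (- b / a) * b + (- b / a)\<^sup>2 * q)"
    using a by (simp add: field_simps power2_eq_square)
  then have "0 \<le> b\<^sup>2 * (q - 2 * a)"
    using quadratic[of "- b / a"] by simp
  then have "b = 0"
    using a by (auto simp: zero_le_mult_iff)
  then have "h = 0"
    by (simp add: b_def inner_l2_self_eq_0)
  then show ?thesis by (simp add: h_def)
qed

section \<open>Spectrum of the deflated matrix\<close>

abbreviation (input) D where "D \<equiv> A ** B - mean_mat w"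

lemma D_mult: "D *v f = A *v (B *v f) - inner_l2 w f 1 *s 1"
  by (simp add: matrix_vector_mult_diff_rdistrib mean_mat_mult_vec mean_fun_eq_inner
      flip: matrix_vector_mul_assoc)

lemma D_one: "D *v 1 = 0"
  by (simp add: D_mult A_one B_one inner_one_one)

text \<open>An eigenvector \<open>f\<close> for \<open>x \<noteq> 0\<close> is orthogonal to the
  constants, because the range of \<open>D\<close> is. The squared norms of \<open>B f\<close> and
  \<open>A B f\<close> are then \<open>x\<close> and \<open>x * x\<close> times that of
  \<open>f\<close>, and the bound on \<open>A\<close> applied to \<open>B f\<close> compares
  them.\<close>

lemma D_eigenvalue_le:
  assumes "poly (charpoly D) x = 0"
  shows "x \<le> s\<^sup>2"
proof (cases "x = 0")
  case False
  obtain f where "f \<noteq> 0" and f: "A *v (B *v f) - inner_l2 w f 1 *s 1 = x *s f"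
    using assms by (auto simp: poly_charpoly_eq_0_iff D_mult)
  have "inner_l2 w (A *v (B *v f) - inner_l2 w f 1 *s 1) 1 = x * inner_l2 w f 1"
    by (simp add: f inner_l2_scale_left)
  then have f1: "inner_l2 w f 1 = 0"
    using False by (simp add: inner_l2_bilinear inner_A_one inner_B_one inner_one_one)
  then have ABf: "A *v (B *v f) = x *s f" and h: "B *v f \<in> V_perp1 w"
    using f by (simp_all add: V_perp1_def inner_B_one)
  define d where "d = inner_l2 w f f"
  have hh: "inner_l2 w (B *v f) (B *v f) = x * d"
    using adjoint[of "B *v f" f] by (simp add: ABf d_def inner_l2_scale_left)
  have d: "0 < d"
    using \<open>f \<noteq> 0\<close> inner_l2_self_nonneg[of f] inner_l2_self_eq_0[of f] by (simp add: d_def less_le)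
  then have "0 < x"
    using inner_l2_self_nonneg[of "B *v f"] False by (simp add: hh zero_le_mult_iff)
  moreover have "x * (x * d) \<le> s\<^sup>2 * (x * d)"
    using inner_A_le[OF h] by (simp add: hh ABf inner_l2_bilinear d_def)
  ultimately show ?thesis
    using d by simp
qed simp

text \<open>\<open>A\<close> carries an eigenvector of \<open>B A\<close> to one of
  \<open>A B\<close>; \<open>s \<noteq> 0\<close> keeps the image nonzero.\<close>

lemma D_eigenvalue:
  assumes "s \<noteq> 0"
  shows "poly (charpoly D) (s\<^sup>2) = 0"
proof -
  obtain f where f: "f \<in> V_perp1 w" "norm_l2 w f = 1" "norm_l2 w (A *v f) = s"
    by (metis maximizer)
  have "A *v f \<noteq> 0"
    using f(3) assms norm_l2_eq_0 by metis
  moreover have "D *v (A *v f) = s\<^sup>2 *s (A *v f)"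
    using f(1) by (simp add: D_mult maximizer_eigenvector[OF f] vector_scalar_commute inner_A_one V_perp1_def)
  ultimately show ?thesis
    by (auto simp: poly_charpoly_eq_0_iff)
qed

text \<open>\<open>D f\<close> is the image under \<open>A\<close> of \<open>B f\<close> less its
  mean, and \<open>A\<close> kills the complement of the constants when
  \<open>s = 0\<close>.\<close>

lemma D_eq_0:
  assumes "s = 0"
  shows "D = 0"
proof -
  have "D *v f = 0" for f
  proof -
    define h where "h = B *v f - inner_l2 w f 1 *s 1"
    have "h \<in> V_perp1 w"
      by (simp add: h_def V_perp1_def inner_l2_bilinear inner_B_one inner_one_one)
    then have "A *v h = 0"
      using norm_A_le[of h] norm_l2_nonneg[of "A *v h"] norm_l2_eq_0 assms by simp
    then show ?thesis
      by (simp add: D_mult h_def matrix_vector_mult_diff_distrib vector_scalar_commute A_one)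
  qed
  then show ?thesis
    by (simp add: matrix_eq)
qed

lemma second_eigenvalue: "eigvals_desc (A ** B) ! 1 = s\<^sup>2"
proof -
  \<comment> \<open>The removed 0 is accounted for by the constants, which \<open>D\<close> kills;
    deflation replaces it by the eigenvalue 1 of \<open>A ** B\<close>.\<close>
  define R where "R = proots (charpoly D) - {#0#}"
  \<comment> \<open>All roots are at most the square of \<open>s\<close>, so the polynomial cannot
    vanish one unit above it.\<close>
  have D: "charpoly D \<noteq> 0"
    using D_eigenvalue_le[of "s\<^sup>2 + 1"] by force
  have deflate: "[:0, 1:] * charpoly (A ** B) = [:-1, 1:] * charpoly D"
    by (intro charpoly_deflate w_sum) (simp add: A_one B_one flip: matrix_vector_mul_assoc)
  then have M: "charpoly (A ** B) \<noteq> 0"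
    using D by (metis mult_zero_right mult_eq_0_iff pCons_eq_0_iff one_neq_zero)
  have "proots ([:0, 1:] * charpoly (A ** B)) = add_mset 0 (proots (charpoly (A ** B)))"
    using proots_linear_factor[of 0] M by (subst proots_mult) auto
  moreover have "proots ([:-1, 1:] * charpoly D) = add_mset 1 (proots (charpoly D))"
    using proots_linear_factor[of "-1"] D by (subst proots_mult) auto
  ultimately have "add_mset 0 (proots (charpoly (A ** B))) = add_mset 1 (proots (charpoly D))"
    by (simp only: deflate)
  moreover have "0 \<in># proots (charpoly D)"
    using D D_one by (auto simp: poly_charpoly_eq_0_iff intro!: exI[of _ 1])
  ultimately have roots: "proots (charpoly (A ** B)) = add_mset 1 R"
    by (metis R_def add_mset_commute add_mset_add_mset_same_iff insert_DiffM)
  have "s\<^sup>2 \<in># R"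
  proof (cases "s = 0")
    case True
    \<comment> \<open>With at least two zeros present, one survives the removal.\<close>
    have "proots (charpoly D) = replicate_mset CARD('n) 0"
      by (simp only: D_eq_0[OF True] proots_charpoly_0)
    then have "count R 0 > 0"
      using card by (simp add: R_def)
    then show ?thesis using True by simp
  next
    case False
    then have "s\<^sup>2 \<in># proots (charpoly D)"
      using D D_eigenvalue by simp
    then show ?thesis
      using False by (simp add: R_def in_diff_count count_eq_zero_iff)
  qed
  moreover have "x \<le> s\<^sup>2" if "x \<in># R" for x
    using that D by (auto simp: R_def intro!: D_eigenvalue_le dest!: in_diffD)
  moreover have "s\<^sup>2 \<le> 1"
    using s_nonneg s_le_1 by (simp add: power_le_one)
  ultimately show ?thesis
    unfolding eigvals_desc_def roots by (rule second_of_sorted_multiset)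
qed

section \<open>Operator norm and distance to stationarity\<close>

lemma diff_mean_in_V_perp: "f - mean_fun w f \<in> V_perp1 w"
  by (simp add: V_perp1_def mean_fun_eq_inner inner_l2_bilinear inner_one_one)

lemma mean_V_perp: "f \<in> V_perp1 w \<Longrightarrow> mean_fun w f = 0"
  by (simp add: V_perp1_def mean_fun_eq_inner)

text \<open>Pythagoras: the variance is the second moment minus the squared mean.\<close>

lemma norm_diff_mean_le: "norm_l2 w (f - mean_fun w f) \<le> norm_l2 w f"
proof -
  have "inner_l2 w (f - mean_fun w f) (f - mean_fun w f) = inner_l2 w f f - (inner_l2 w f 1)\<^sup>2"
    by (simp add: mean_fun_eq_inner inner_l2_bilinear inner_one_one inner_l2_commute[of w 1 f]
        power2_eq_square)
  then show ?thesis by (simp add: norm_l2_def)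
qed

text \<open>\<open>U_perp1 w\<close> subtracts the mean, so it maps into the complement without
  increasing norms and leaves the maximizer unchanged.\<close>

lemma opnorm_U: "opnorm_l2 w (A ** U_perp1 w) = s"
proof -
  have U: "A ** U_perp1 w *v f = A *v (f - mean_fun w f)" for f
  proof -
    have "U_perp1 w = mat 1 - mean_mat w"
      by (simp add: U_perp1_def mean_mat_def columnvector_def rowvector_def
          matrix_matrix_mult_def vec_eq_iff)
    then show ?thesis
      by (simp add: matrix_vector_mult_diff_rdistrib mean_mat_mult_vec flip: matrix_vector_mul_assoc)
  qed
  obtain f where f: "f \<in> V_perp1 w" "norm_l2 w f = 1" "norm_l2 w (A *v f) = s"
    by (metis maximizer)
  show ?thesis
    unfolding opnorm_l2_def U
  proof (rule cSup_eq_maximum)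
    show "s \<in> (\<lambda>f. norm_l2 w (A *v (f - mean_fun w f))) ` {f. norm_l2 w f = 1}"
      using f by (auto simp: mean_V_perp intro!: image_eqI[of _ _ f])
  next
    fix y assume "y \<in> (\<lambda>f. norm_l2 w (A *v (f - mean_fun w f))) ` {f. norm_l2 w f = 1}"
    then obtain g where g: "norm_l2 w g = 1" "y = norm_l2 w (A *v (g - mean_fun w g))"
      by auto
    have "y \<le> s * norm_l2 w (g - mean_fun w g)"
      unfolding g(2) by (intro norm_A_le diff_mean_in_V_perp)
    also have "\<dots> \<le> s * norm_l2 w g"
      by (intro mult_left_mono norm_diff_mean_le s_nonneg)
    finally show "y \<le> s" by (simp add: g(1))
  qed
qed

lemma dist_eq_s:
  "(SUP f\<in>{f. norm_l2 w (f - mean_fun w f) = 1}. norm_l2 w (A *v f - mean_fun w f)) = s"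
proof -
  \<comment> \<open>\<open>A\<close> fixes constants, so both the constraint and the objective
    depend only on \<open>f - mean_fun w f\<close>.\<close>
  have *: "A *v f - mean_fun w f = A *v (f - mean_fun w f)" for f
    by (simp add: matrix_vector_mult_diff_distrib mean_fun_eq_inner vector_scalar_commute A_one)
  obtain f where f: "f \<in> V_perp1 w" "norm_l2 w f = 1" "norm_l2 w (A *v f) = s"
    by (metis maximizer)
  show ?thesis
    unfolding *
  proof (rule cSup_eq_maximum)
    show "s \<in> (\<lambda>f. norm_l2 w (A *v (f - mean_fun w f))) ` {f. norm_l2 w (f - mean_fun w f) = 1}"
      using f by (auto simp: mean_V_perp intro!: image_eqI[of _ _ f])
  qed (auto intro: norm_A_le_sphere diff_mean_in_V_perp)
qed

end

subsection \<open>Powers of a chain\<close>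

lemma mat_pow_commute: "mat_pow A k ** A = A ** mat_pow A k"
  by (induction k) (simp_all flip: matrix_mul_assoc)

text \<open>Adjoints reverse products, which is harmless here since a matrix commutes with its
  powers.\<close>

lemma mat_pow_adjoint:
  assumes "\<And>f g. inner_l2 w (A *v f) g = inner_l2 w f (B *v g)"
  shows "inner_l2 w (mat_pow A k *v f) g = inner_l2 w f (mat_pow B k *v g)"
proof (induction k arbitrary: g)
  case (Suc k)
  have "inner_l2 w (mat_pow A (Suc k) *v f) g = inner_l2 w f (mat_pow B k *v (B *v g))"
    by (simp add: assms Suc flip: matrix_vector_mul_assoc)
  then show ?case
    by (simp add: matrix_vector_mul_assoc mat_pow_commute)
qed simp

lemma mat_pow_nonneg:
  assumes "\<And>i j. 0 \<le> A $ i $ j"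
  shows "0 \<le> mat_pow A k $ i $ j"
proof (induction k arbitrary: i j)
  case (Suc k)
  then show ?case
    by (auto simp: matrix_matrix_mult_def assms intro!: sum_nonneg)
qed (simp add: mat_def)

lemma mat_pow_fixes: "A *v f = f \<Longrightarrow> mat_pow A k *v f = f"
  by (induction k) (simp_all flip: matrix_vector_mul_assoc)

lemma mat_pow_fixes_left: "f v* A = f \<Longrightarrow> f v* mat_pow A k = f"
  by (induction k) (simp_all flip: vector_matrix_mul_assoc)

theorem theorem3p1:
  fixes P :: "real^'n^'n" and w :: "real^'n" and k :: nat
  assumes "CARD('n) \<ge> 2"
    and "row_stochastic P"
    and "irreducible_chain P"
    and "aperiodic_chain P"
    and "positive_stationary w P"
    and "k \<ge> 1"
  shows "opnorm_l2 w (mat_pow P k ** U_perp1 w)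
           = (SUP f\<in>{f \<in> V_perp1 w. norm_l2 w f = 1}. norm_l2 w (mat_pow P k *v f))
       \<and> (SUP f\<in>{f \<in> V_perp1 w. norm_l2 w f = 1}. norm_l2 w (mat_pow P k *v f))
           = dist_stationary_l2 w P k
       \<and> dist_stationary_l2 w P k = sigma_pow w 2 P k"
proof -
  have pos: "0 < w $ i" for i
    using assms(5) by (simp add: positive_stationary_def)
  have "inner_l2 w (P *v f) g = inner_l2 w f (adjoint_l2 w P *v g)" for f g
  proof -
    \<comment> \<open>\<open>adjoint_l2\<close> is a definite description, so its property becomes
      available only through unique existence.\<close>
    have "\<exists>!B. \<forall>f g. inner_l2 w (P *v f) g = inner_l2 w f (B *v g)"
      by (simp add: adjoint_l2_unique[OF pos])
    from theI'[OF this, folded adjoint_l2_def] show ?thesis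
      by blast
  qed
  moreover have "P *v 1 = 1"
    using assms(2) by (simp add: row_stochastic_def matrix_vector_mult_def vec_eq_iff)
  ultimately interpret markov_l2 w "mat_pow P k" "mat_pow (adjoint_l2 w P) k"
    using assms(1,2,5)
    by unfold_locales (simp_all add: pos positive_stationary_def row_stochastic_def
        mat_pow_nonneg mat_pow_fixes mat_pow_fixes_left mat_pow_adjoint)
  \<comment> \<open>The index 2 of \<open>sigma_pow\<close> reads list entry 1, and
    \<open>s_nonneg\<close> turns the square root of the squared \<open>s\<close> into
    \<open>s\<close>.\<close>
  show ?thesis
    using opnorm_U dist_eq_s second_eigenvalue s_nonneg
    by (simp add: s_def dist_stationary_l2_def sigma_pow_def)
qed

end
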